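(* The limit $\mathcal P_{q\text{-sym}}=\lim_{M\to\infty}P^M$ is a well-defined projection on $T$ (that is, for every $n$ and $u\in T^n$ the sequence $P^M(u)$ is eventually constant, its limit is independent of the choices of expressions used to define $P$, and $\mathcal P_{q\text{-sym}}^2=\mathcal P_{q\text{-sym}}$), and it satisfies $$\mathcal P_{q\text{-sym}}(I_R)=0.$$
   Context: Setting. $V$ is a complex vector space with basis $X_1,\dots,X_N$; $T=T(V)=\bigoplus_{r\ge 0}T^r$, $T^r=V^{\otimes r}$; the sign $\otimes$ is often omitted. Fix $q\in\mathbb C^*$ and, for $N\ge i>j\ge 1$, nonzero complex numbers of the form $b_{ij}=q^{\alpha_{ij}}$ and elements $p_{ij}\in\mathrm{Span}\{X_aX_b\mid 1\le a,b\le i-1\}\subset T^2$. $I_R\subset T$ is the two-sided ideal generated by all $X_iX_j-b_{ij}X_jX_i-p_{ij}$ ($i>j$). Order. For a monomial $X=X_{i_1}\cdots X_{i_r}\in T^r$ put $\ell(X)=(n_1,\dots,n_N)$, $n_i=\#\{s\mid i_s=i\}$. On $\{0,\dots,r\}^N$ use the lexicographic order $\le_l$ in which the last coordinate is most significant (so $(0,\dots,0,r)$ is the biggest). For monomials $u,u'\in T^r$, $u'\le_l u$ means $\ell(u')\le_l\ell(u)$; the order of a nonzero element of $T^r$ is the largest $\ell$ of the monomials occurring in it, and elements are compared via their orders. Standing assumption (EA): every nonzero homogeneous $u\in I_R$ lies in the span of the elements $a(X_iX_j-b_{ij}X_jX_i-p_{ij})b$ with $i>j$, $a,b$ monomials in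 $T$, and $aX_iX_jb\le_l u$. Operators. $S:V\otimes V\to V\otimes V$ is the linear map with $S(X_iX_j)=b_{ij}X_jX_i+p_{ij}$ and $S(X_jX_i)=b_{ij}^{-1}(X_iX_j-p_{ij})$ for $i>j$, and $S(X_iX_i)=X_iX_i$. On $T^n$, $\sigma_i$ ($1\le i\le n-1$) is $S$ applied in tensor positions $i,i+1$. For each $\sigma\in S_n$ (symmetric group) choose an expression $\sigma=s_{i_1}\cdots s_{i_m}$ as a product of elementary transpositions $s_j=(j\ j{+}1)$ and put $\widehat\sigma=\sigma_{i_1}\cdots\sigma_{i_m}$; put $P=\frac1{n!}\sum_{\sigma\in S_n}\widehat\sigma$ on $T^n$. This is done for every $n$, giving a degree-preserving operator $P$ on $T$. *)

theory Defs
  imports "HOL-Analysis.Analysis" "HOL-Library.Poly_Mapping" "HOL-Combinatorics.Permutations"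
begin

text \<open>
  The basis of V is indexed by a nonempty finite linearly ordered type 'n (in place of
  1 < ... < N), so that N = CARD('n).  The tensor algebra of V is realised as the monoid
  algebra over the complex numbers of the free monoid on 'n: the word [i1, ..., ir] stands for
  the tensor monomial X_i1 ... X_ir, and multiplication is the tensor product.  The type of words
  is a copy of the list type because the ring structure on polynomial mappings is obtained from
  the class monoid_add; here + is concatenation.
\<close>

datatype 'n mon = Mon (letters: "'n list")

instantiation mon :: (type) monoid_add
begin

definition zero_mon :: "'a mon" where "0 = Mon []"

definition plus_mon :: "'a mon \<Rightarrow> 'a mon \<Rightarrow> 'a mon" where
  "u + v = Mon (letters u @ letters v)"

instance by standard (simp_all add: zero_mon_def plus_mon_def)

end

type_synonym 'n tensor = "'n mon \<Rightarrow>\<^sub>0 complex"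

definition scale :: "complex \<Rightarrow> 'n tensor \<Rightarrow> 'n tensor" where
  "scale c u = Poly_Mapping.single 0 c * u"

interpretation tensor: vector_space scale
proof
  fix a c :: complex and u v :: "'n tensor"
  show "scale a (u + v) = scale a u + scale a v"
    by (simp add: scale_def distrib_left)
  show "scale (a + c) u = scale a u + scale c u"
    by (simp add: scale_def single_add distrib_right)
  show "scale a (scale c u) = scale (a * c) u"
    by (simp add: scale_def mult.assoc[symmetric] mult_single)
  show "scale 1 u = u"
    by (simp add: scale_def)
qed

definition monom :: "'n list \<Rightarrow> 'n tensor" where
  "monom w = Poly_Mapping.single (Mon w) 1"

definition X :: "'n \<Rightarrow> 'n tensor" where
  "X i = monom [i]"

definition monoms_of :: "'n tensor \<Rightarrow> 'n list set" where
  "monoms_of u = letters ` Poly_Mapping.keys u"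

definition homog :: "nat \<Rightarrow> 'n tensor set" where
  "homog r = {u. \<forall>w \<in> monoms_of u. length w = r}"

definition lin_ext :: "('n list \<Rightarrow> 'n tensor) \<Rightarrow> 'n tensor \<Rightarrow> 'n tensor" where
  "lin_ext f u = (\<Sum>w \<in> Poly_Mapping.keys u. scale (Poly_Mapping.lookup u w) (f (letters w)))"

text \<open>In all definitions below, b i j and p i j are only used for i > j.\<close>

definition rel :: "('n \<Rightarrow> 'n \<Rightarrow> complex) \<Rightarrow> ('n \<Rightarrow> 'n \<Rightarrow> 'n tensor) \<Rightarrow> 'n \<Rightarrow> 'n \<Rightarrow> 'n tensor" where
  "rel b p i j = X i * X j - scale (b i j) (X j * X i) - p i j"

definition two_sided_ideal :: "'a::ring_1 set \<Rightarrow> bool" where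
  "two_sided_ideal I \<longleftrightarrow>
     0 \<in> I \<and> (\<forall>u \<in> I. \<forall>v \<in> I. u + v \<in> I) \<and> (\<forall>u \<in> I. \<forall>a. a * u \<in> I \<and> u * a \<in> I)"

definition I_R :: "('n::linorder \<Rightarrow> 'n \<Rightarrow> complex) \<Rightarrow> ('n \<Rightarrow> 'n \<Rightarrow> 'n tensor) \<Rightarrow> 'n tensor set" where
  "I_R b p = two_sided_ideal hull {rel b p i j | i j. j < i}"

definition ell :: "'n list \<Rightarrow> 'n \<Rightarrow> nat" where
  "ell w i = count_list w i"

text \<open>Lexicographic order on exponent vectors, the largest index being the most significant one.\<close>

definition lex_le :: "('n::linorder \<Rightarrow> nat) \<Rightarrow> ('n \<Rightarrow> nat) \<Rightarrow> bool" (infix \<open>\<le>\<^sub>l\<close> 50) where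
  "m \<le>\<^sub>l m' \<longleftrightarrow> m = m' \<or> (\<exists>k. m k < m' k \<and> (\<forall>j > k. m j = m' j))"

definition tensor_order :: "'n::linorder tensor \<Rightarrow> 'n \<Rightarrow> nat" where
  "tensor_order u =
     (THE m. m \<in> ell ` monoms_of u \<and> (\<forall>m' \<in> ell ` monoms_of u. m' \<le>\<^sub>l m))"

text \<open>
  Since the order compares monomials of the same degree,
  a X_i X_j b' has the degree of the homogeneous element u.
\<close>

definition EA :: "('n::linorder \<Rightarrow> 'n \<Rightarrow> complex) \<Rightarrow> ('n \<Rightarrow> 'n \<Rightarrow> 'n tensor) \<Rightarrow> bool" where
  "EA b p \<longleftrightarrow>
     (\<forall>r. \<forall>u \<in> I_R b p. u \<in> homog r \<and> u \<noteq> 0 \<longrightarrow>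
        u \<in> tensor.span {monom a * rel b p i j * monom b' | a i j b'.
               j < i \<and> length (a @ [i, j] @ b') = r \<and> ell (a @ [i, j] @ b') \<le>\<^sub>l tensor_order u})"

definition S_val ::
  "('n::linorder \<Rightarrow> 'n \<Rightarrow> complex) \<Rightarrow> ('n \<Rightarrow> 'n \<Rightarrow> 'n tensor) \<Rightarrow> 'n \<Rightarrow> 'n \<Rightarrow> 'n tensor" where
  "S_val b p k l =
     (if l < k then scale (b k l) (X l * X k) + p k l
      else if k < l then scale (inverse (b l k)) (X l * X k - p l k)
      else X k * X k)"

text \<open>
  S applied in positions i, i + 1 (counted from 1).  Words with fewer than i + 1 letters, on
  which the operator is not used, are fixed.
\<close>

definition sigma ::
  "('n::linorder \<Rightarrow> 'n \<Rightarrow> complex) \<Rightarrow> ('n \<Rightarrow> 'n \<Rightarrow> 'n tensor) \<Rightarrow> nat \<Rightarrow> 'n tensor \<Rightarrow> 'n tensor" where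
  "sigma b p i = lin_ext (\<lambda>w.
     if 1 \<le> i \<and> i < length w
     then monom (take (i - 1) w) * S_val b p (w ! (i - 1)) (w ! i) * monom (drop (i + 1) w)
     else monom w)"

text \<open>A list [i1, ..., im] of indices is an expression s_i1 ... s_im.\<close>

definition perm_of_expr :: "nat list \<Rightarrow> nat \<Rightarrow> nat" where
  "perm_of_expr js = foldr (\<lambda>j f. Transposition.transpose j (Suc j) \<circ> f) js id"

definition op_of_expr ::
  "('n::linorder \<Rightarrow> 'n \<Rightarrow> complex) \<Rightarrow> ('n \<Rightarrow> 'n \<Rightarrow> 'n tensor) \<Rightarrow> nat list \<Rightarrow> 'n tensor \<Rightarrow> 'n tensor" where
  "op_of_expr b p js = foldr (\<lambda>j f. sigma b p j \<circ> f) js id"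

text \<open>
  e n s is the expression chosen for the permutation s of {1..n}.  Expressions need not be reduced.
\<close>

definition expr_choice :: "(nat \<Rightarrow> (nat \<Rightarrow> nat) \<Rightarrow> nat list) \<Rightarrow> bool" where
  "expr_choice e \<longleftrightarrow>
     (\<forall>n s. s permutes {1..n} \<longrightarrow> set (e n s) \<subseteq> {1..<n} \<and> perm_of_expr (e n s) = s)"

definition P_deg ::
  "('n::linorder \<Rightarrow> 'n \<Rightarrow> complex) \<Rightarrow> ('n \<Rightarrow> 'n \<Rightarrow> 'n tensor) \<Rightarrow>
   (nat \<Rightarrow> (nat \<Rightarrow> nat) \<Rightarrow> nat list) \<Rightarrow> nat \<Rightarrow> 'n tensor \<Rightarrow> 'n tensor" where
  "P_deg b p e n u =
     scale (1 / fact n) (\<Sum>s \<in> {s. s permutes {1..n}}. op_of_expr b p (e n s) u)"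

definition P_op ::
  "('n::linorder \<Rightarrow> 'n \<Rightarrow> complex) \<Rightarrow> ('n \<Rightarrow> 'n \<Rightarrow> 'n tensor) \<Rightarrow>
   (nat \<Rightarrow> (nat \<Rightarrow> nat) \<Rightarrow> nat list) \<Rightarrow> 'n tensor \<Rightarrow> 'n tensor" where
  "P_op b p e = lin_ext (\<lambda>w. P_deg b p e (length w) (monom w))"

text \<open>The limit of the powers of P is the eventual value of the sequence of powers at each point.\<close>

definition P_qsym ::
  "('n::linorder \<Rightarrow> 'n \<Rightarrow> complex) \<Rightarrow> ('n \<Rightarrow> 'n \<Rightarrow> 'n tensor) \<Rightarrow>
   (nat \<Rightarrow> (nat \<Rightarrow> nat) \<Rightarrow> nat list) \<Rightarrow> 'n tensor \<Rightarrow> 'n tensor" where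
  "P_qsym b p e u = (THE v. \<forall>\<^sub>F M in sequentially. (P_op b p e ^^ M) u = v)"

end

theory Submission
  imports Defs
begin

text \<open>
  Rescaling every monomial w by the product of the b's over its pairs of positions with ascending
  letters turns each \<open>\<sigma>\<^sub>k\<close>, up to terms of lower order, into the plain exchange of two neighbouring
  letters.  Hence P acts on leading terms as the symmetriser, and EA implies that P strictly
  lowers the order of elements of \<open>I\<^sub>R\<close>; it maps \<open>I\<^sub>R\<close> into itself, so it is locally nilpotent
  there.  On the other hand the symmetrised rescaled monomials are fixed exactly by every \<open>\<sigma>\<^sub>k\<close>,
  because the contributions of \<open>p\<^sub>i\<^sub>j\<close> cancel in pairs, and together with \<open>I\<^sub>R\<close> they span T.
  The limit is therefore the projection onto their span along \<open>I\<^sub>R\<close>, for any choice of expressions.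
\<close>

section \<open>Linear algebra in the tensor algebra\<close>

abbreviation tensor_linear :: "('n tensor \<Rightarrow> 'm tensor) \<Rightarrow> bool" where
  "tensor_linear \<equiv> Vector_Spaces.linear scale scale"

lemma tensor_linearI:
  assumes "\<And>u v. f (u + v) = f u + f v" "\<And>c u. f (scale c u) = scale c (f u)"
  shows "tensor_linear f"
  using assms by (simp add: Vector_Spaces.linear_iff tensor.vector_space_axioms)

lemma
  assumes "tensor_linear f"
  shows tensor_linear_add: "f (u + v) = f u + f v"
    and tensor_linear_scale: "f (scale c u) = scale c (f u)"
    and tensor_linear_diff: "f (u - v) = f u - f v"
    and tensor_linear_sum: "f (sum g A) = (\<Sum>x\<in>A. f (g x))"
    and tensor_linear_0: "f 0 = 0"
proof -
  interpret Vector_Spaces.linear scale scale f by fact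
  show "f (u + v) = f u + f v" "f (scale c u) = scale c (f u)" "f (u - v) = f u - f v"
    "f (sum g A) = (\<Sum>x\<in>A. f (g x))" "f 0 = 0"
    by (fact add scale diff sum zero)+
qed

lemma tensor_linear_id: "tensor_linear id"
  by (rule tensor_linearI) auto

lemma tensor_linear_diff_id: "tensor_linear f \<Longrightarrow> tensor_linear (\<lambda>u. f u - u)"
  by (rule tensor_linearI)
    (auto simp: tensor_linear_add tensor_linear_scale tensor.scale_right_diff_distrib)

lemma tensor_linear_funpow:
  fixes f :: "'n tensor \<Rightarrow> 'n tensor"
  assumes "tensor_linear f"
  shows "tensor_linear (f ^^ M)"
proof (rule tensor_linearI)
  show "(f ^^ M) (u + v) = (f ^^ M) u + (f ^^ M) v" for u v
    by (induction M) (simp_all add: tensor_linear_add[OF assms])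
  show "(f ^^ M) (scale c u) = scale c ((f ^^ M) u)" for c u
    by (induction M) (simp_all add: tensor_linear_scale[OF assms])
qed

lemma subspace_vimage_linear:
  assumes "tensor_linear f" "tensor.subspace U"
  shows "tensor.subspace {u. f u \<in> U}"
  unfolding tensor.subspace_def
  using assms
  by (auto simp: tensor_linear_add tensor_linear_scale tensor_linear_0
      tensor.subspace_0 tensor.subspace_add tensor.subspace_scale)

lemma lookup_scale [simp]: "Poly_Mapping.lookup (scale c u) k = c * Poly_Mapping.lookup u k"
  unfolding scale_def mult_map_scale_conv_mult[symmetric]
  by (simp add: Poly_Mapping.map.rep_eq when_def)

lemma scale_mult_left: "scale c u * v = scale c (u * v)"
  by (simp add: scale_def mult.assoc)

lemma sum_monomials: "u = (\<Sum>k\<in>Poly_Mapping.keys u. scale (Poly_Mapping.lookup u k) (monom (letters k)))"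
  by (rule poly_mapping_eqI)
    (auto simp: lookup_sum monom_def lookup_single when_def in_keys_iff if_distrib[of "\<lambda>x. _ * x"] sum.delta
      cong: if_cong)

text \<open>Scalars act by left multiplication with a multiple of the empty word; that element is
  central because it commutes with every monomial.\<close>

lemma scale_eq_mult_right: "scale c u = u * Poly_Mapping.single 0 c"
proof -
  have "Poly_Mapping.single 0 c * scale d (monom w) = scale d (monom w) * Poly_Mapping.single 0 c"
    for d and w :: "'a list"
    by (simp add: monom_def scale_def mult_single mult.commute)
  then have "Poly_Mapping.single 0 c * (\<Sum>k\<in>K. scale (g k) (monom (letters k))) =
      (\<Sum>k\<in>K. scale (g k) (monom (letters k))) * Poly_Mapping.single 0 c"
    for K :: "'a mon set" and g
    by (simp add: sum_distrib_left sum_distrib_right)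
  from this[of "Poly_Mapping.lookup u" "Poly_Mapping.keys u"] show ?thesis
    unfolding scale_def[of c u] sum_monomials[of u, symmetric] .
qed

lemma scale_mult_right: "u * scale c v = scale c (u * v)"
  by (simp add: scale_eq_mult_right mult.assoc)

lemma tensor_linear_sandwich: "tensor_linear (\<lambda>u. a * u * d)"
  by (rule tensor_linearI) (auto simp: scale_mult_left scale_mult_right algebra_simps)

lemma monom_mult: "monom u * monom v = monom (u @ v)"
  by (simp add: monom_def mult_single plus_mon_def)

lemma monom_Nil [simp]: "monom [] = 1"
  by (simp add: monom_def zero_mon_def[symmetric])

lemma monoms_of_monom [simp]: "monoms_of (monom w) = {w}"
  by (simp add: monoms_of_def monom_def)

text \<open>A common index set for several tensors makes their sums comparable term by term; extra
  indices have coefficient zero.\<close>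

lemma lin_ext_eq_sum:
  assumes "finite K" "Poly_Mapping.keys u \<subseteq> K"
  shows "lin_ext f u = (\<Sum>w\<in>K. scale (Poly_Mapping.lookup u w) (f (letters w)))"
  unfolding lin_ext_def using assms
  by (intro sum.mono_neutral_left) (auto simp: in_keys_iff)

lemma tensor_linear_lin_ext: "tensor_linear (lin_ext f)"
proof (rule tensor_linearI)
  fix u v :: "'a tensor" and c
  let ?K = "Poly_Mapping.keys u \<union> Poly_Mapping.keys v"
  have "Poly_Mapping.keys (u + v) \<subseteq> ?K"
    by (rule keys_add)
  then show "lin_ext f (u + v) = lin_ext f u + lin_ext f v"
    by (simp add: lin_ext_eq_sum[of ?K] lookup_add tensor.scale_left_distrib sum.distrib)
  have "Poly_Mapping.keys (scale c u) \<subseteq> Poly_Mapping.keys u"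
    by (auto simp: in_keys_iff)
  then show "lin_ext f (scale c u) = scale c (lin_ext f u)"
    by (simp add: lin_ext_eq_sum[of "Poly_Mapping.keys u"] tensor.scale_sum_right)
qed

lemma lin_ext_monom [simp]: "lin_ext f (monom w) = f w"
  by (simp add: lin_ext_def monom_def)

text \<open>Unlike a condition on \<open>tensor_order\<close>, this also covers 0 and so gives a
  subspace for every \<open>S\<close>.\<close>

definition supp_in :: "'n list set \<Rightarrow> 'n tensor set" where
  "supp_in S = {u. monoms_of u \<subseteq> S}"

lemma monom_in_supp_in [simp]: "monom w \<in> supp_in S \<longleftrightarrow> w \<in> S"
  by (simp add: supp_in_def)

lemma subspace_supp_in: "tensor.subspace (supp_in S)"
proof -
  have "monoms_of (scale c u) \<subseteq> monoms_of u" for c and u :: "'a tensor"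
    by (auto simp: monoms_of_def in_keys_iff)
  moreover have "monoms_of (u + v) \<subseteq> monoms_of u \<union> monoms_of v" for u v :: "'a tensor"
    using keys_add[of u v] by (auto simp: monoms_of_def)
  moreover have "monoms_of (0 :: 'a tensor) = {}"
    by (simp add: monoms_of_def)
  ultimately show ?thesis
    unfolding tensor.subspace_def supp_in_def mem_Collect_eq by (blast intro: subset_trans)
qed

lemma supp_in_eq_span: "supp_in S = tensor.span (monom ` S)"
proof
  show "tensor.span (monom ` S) \<subseteq> supp_in S"
    by (rule tensor.span_minimal) (auto simp: subspace_supp_in)
  show "supp_in S \<subseteq> tensor.span (monom ` S)"
  proof
    fix u :: "'a tensor"
    assume "u \<in> supp_in S"
    then show "u \<in> tensor.span (monom ` S)"
      by (subst sum_monomials, intro tensor.span_sum tensor.span_scale tensor.span_base)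
        (auto simp: supp_in_def monoms_of_def)
  qed
qed

lemma supp_in_mono: "S \<subseteq> T \<Longrightarrow> supp_in S \<subseteq> supp_in T"
  by (auto simp: supp_in_def)

lemma span_induct_linear:
  assumes "u \<in> tensor.span B" "tensor_linear f" "tensor.subspace U" "\<And>v. v \<in> B \<Longrightarrow> f v \<in> U"
  shows "f u \<in> U"
  using tensor.span_minimal[OF _ subspace_vimage_linear[OF assms(2,3)], of B] assms(1,4) by auto

lemma supp_in_induct_linear:
  assumes "u \<in> supp_in S" "tensor_linear f" "tensor.subspace U" "\<And>w. w \<in> S \<Longrightarrow> f (monom w) \<in> U"
  shows "f u \<in> U"
  using assms span_induct_linear[of u "monom ` S" f U] by (auto simp: supp_in_eq_span)

lemma homog_eq_supp_in: "homog n = supp_in {w. length w = n}"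
  by (auto simp: homog_def supp_in_def)

section \<open>The lexicographic order\<close>

lemma lex_le_refl: "m \<le>\<^sub>l m"
  by (simp add: lex_le_def)

lemma lex_le_trans:
  assumes "m1 \<le>\<^sub>l m2" "m2 \<le>\<^sub>l m3"
  shows "m1 \<le>\<^sub>l m3"
proof (cases "m1 = m2 \<or> m2 = m3")
  case False
  then obtain k l where k: "m1 k < m2 k" "\<forall>j>k. m1 j = m2 j" and l: "m2 l < m3 l" "\<forall>j>l. m2 j = m3 j"
    using assms by (auto simp: lex_le_def)
  \<comment> \<open>At the larger of the two witnesses one comparison is strict and the other is
    strict or an equality.\<close>
  have "m1 (max k l) < m3 (max k l)"
    using k l by (cases k l rule: linorder_cases) (force simp: max_def)+
  moreover have "\<forall>j>max k l. m1 j = m3 j"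
    using k(2) l(2) by auto
  ultimately show ?thesis
    unfolding lex_le_def by blast
qed (use assms in auto)

lemma lex_le_antisym:
  assumes "m1 \<le>\<^sub>l m2" "m2 \<le>\<^sub>l m1"
  shows "m1 = m2"
proof (rule ccontr)
  assume "m1 \<noteq> m2"
  then obtain k l where k: "m1 k < m2 k" "\<forall>j>k. m1 j = m2 j" and l: "m2 l < m1 l" "\<forall>j>l. m2 j = m1 j"
    using assms by (auto simp: lex_le_def)
  then show False
    by (cases k l rule: linorder_cases) force+
qed

text \<open>The largest index where the vectors differ decides; it exists because the index type is
  finite.\<close>

lemma lex_le_total:
  fixes m1 m2 :: "'n::{finite,linorder} \<Rightarrow> nat"
  shows "m1 \<le>\<^sub>l m2 \<or> m2 \<le>\<^sub>l m1"
proof (cases "m1 = m2")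
  case False
  let ?D = "{k. m1 k \<noteq> m2 k}"
  have D: "finite ?D" "?D \<noteq> {}"
    using False by auto
  have "m1 (Max ?D) \<noteq> m2 (Max ?D)"
    using Max_in[OF D] by simp
  moreover have "\<forall>j>Max ?D. m1 j = m2 j"
    using Max_ge[OF D(1)] by (metis (mono_tags) leD mem_Collect_eq)
  ultimately show ?thesis
    unfolding lex_le_def by (metis (no_types, lifting) linorder_neqE_nat)
qed (simp add: lex_le_refl)

lemma finite_ex_lex_max:
  fixes A :: "('n::{finite,linorder} \<Rightarrow> nat) set"
  assumes "finite A" "A \<noteq> {}"
  shows "\<exists>m\<in>A. \<forall>m'\<in>A. m' \<le>\<^sub>l m"
  using assms
proof (induction rule: finite_ne_induct)
  case (insert x F)
  then obtain m where m: "m \<in> F" "\<forall>m'\<in>F. m' \<le>\<^sub>l m"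
    by blast
  show ?case
  proof (cases "x \<le>\<^sub>l m")
    case True
    then show ?thesis using m by auto
  next
    case False
    then have "m \<le>\<^sub>l x" using lex_le_total by blast
    then show ?thesis using m lex_le_refl lex_le_trans by blast
  qed
qed (simp add: lex_le_refl)

text \<open>Justifies the description in \<open>tensor_order\<close>: finitely many exponent vectors
  have a greatest one by totality, unique by antisymmetry.\<close>

lemma tensor_order_props:
  fixes u :: "'n::{finite,linorder} tensor"
  assumes "u \<noteq> 0"
  shows "tensor_order u \<in> ell ` monoms_of u" "\<And>w. w \<in> monoms_of u \<Longrightarrow> ell w \<le>\<^sub>l tensor_order u"
proof -
  let ?Q = "\<lambda>m. m \<in> ell ` monoms_of u \<and> (\<forall>m' \<in> ell ` monoms_of u. m' \<le>\<^sub>l m)"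
  have "\<exists>m. ?Q m"
    using finite_ex_lex_max[of "ell ` monoms_of u"] assms by (auto simp: monoms_of_def)
  then have "\<exists>!m. ?Q m"
    by (metis lex_le_antisym)
  then have "?Q (tensor_order u)"
    unfolding tensor_order_def by (rule theI')
  then show "tensor_order u \<in> ell ` monoms_of u" "\<And>w. w \<in> monoms_of u \<Longrightarrow> ell w \<le>\<^sub>l tensor_order u"
    by auto
qed

text \<open>Membership in \<open>supp_in (below n m)\<close> expresses strictly lower order; the
  cardinality of this finite set is the measure of the later inductions.\<close>

definition below :: "nat \<Rightarrow> ('n::linorder \<Rightarrow> nat) \<Rightarrow> 'n list set" where
  "below n m = {w. length w = n \<and> ell w \<le>\<^sub>l m \<and> ell w \<noteq> m}"

lemma finite_below: "finite (below n m)" for m :: "'n::{finite,linorder} \<Rightarrow> nat"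
  by (rule finite_subset[OF _ finite_lists_length_eq[of UNIV n]]) (auto simp: below_def)

lemma below_mono: "m \<le>\<^sub>l m' \<Longrightarrow> below n m \<subseteq> below n m'"
  unfolding below_def using lex_le_trans lex_le_antisym by blast

lemma below_psubset: "w \<in> below n m \<Longrightarrow> below n (ell w) \<subset> below n m"
  using below_mono[of "ell w" m n] by (auto simp: below_def)

text \<open>The count of \<open>i\<close> drops by one and the counts of larger letters stay,
  whatever happens to smaller ones.\<close>

lemma below_replace_two:
  assumes "j < i" "k < i" "l < i"
  shows "a @ [k, l] @ d \<in> below (length (a @ [i, j] @ d)) (ell (a @ [i, j] @ d))"
proof -
  have "ell (a @ [k, l] @ d) i < ell (a @ [i, j] @ d) i"
    using assms by (auto simp: ell_def)
  moreover have "\<forall>x>i. ell (a @ [k, l] @ d) x = ell (a @ [i, j] @ d) x"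
    using assms by (auto simp: ell_def)
  ultimately show ?thesis
    unfolding below_def lex_le_def by fastforce
qed

section \<open>Permuting the letters of a word\<close>

text \<open>The letter at position \<open>m\<close> moves to position \<open>s m\<close>; the
  inverse makes this a left action. Positions count from 1, list indices from 0.\<close>

definition permute_word :: "(nat \<Rightarrow> nat) \<Rightarrow> 'n list \<Rightarrow> 'n list" where
  "permute_word s w = map (\<lambda>i. w ! (inv s i - 1)) [1..<Suc (length w)]"

lemma length_permute_word [simp]: "length (permute_word s w) = length w"
  by (simp add: permute_word_def del: upt_Suc)

lemma nth_permute_word: "i < length w \<Longrightarrow> permute_word s w ! i = w ! (inv s (Suc i) - 1)"
  by (simp add: permute_word_def del: upt_Suc)

lemma permute_word_id [simp]: "permute_word id w = w"
  by (rule nth_equalityI) (auto simp: nth_permute_word)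

lemma permute_word_compose:
  assumes s: "s permutes {1..length w}" and t: "t permutes {1..length w}"
  shows "permute_word (s \<circ> t) w = permute_word s (permute_word t w)"
proof (rule nth_equalityI)
  fix i
  assume "i < length (permute_word (s \<circ> t) w)"
  then have i: "i < length w" by simp
  have "inv s (Suc i) \<in> {1..length w}"
    using permutes_in_image[OF permutes_inv[OF s], of "Suc i"] i by auto
  moreover have "inv (s \<circ> t) = inv t \<circ> inv s"
    using s t by (simp add: o_inv_distrib permutes_bij)
  ultimately show "permute_word (s \<circ> t) w ! i = permute_word s (permute_word t w) ! i"
    using i by (auto simp: nth_permute_word)
qed simp

lemma mset_permute_word:
  assumes s: "s permutes {1..length w}"
  shows "mset (permute_word s w) = mset w"
proof -
  let ?I = "{1..length w}"
  have mset_w: "mset (permute_word t w) = image_mset (\<lambda>i. w ! (i - 1)) (image_mset (inv t) (mset_set ?I))" for t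
  proof -
    have "mset_set ?I = mset [1..<Suc (length w)]"
      by (metis atLeastLessThanSuc_atLeastAtMost mset_upt)
    then show ?thesis
      by (simp add: permute_word_def multiset.map_comp comp_def del: upt_Suc)
  qed
  have "image_mset (inv s) (mset_set ?I) = mset_set (inv s ` ?I)"
    by (rule image_mset_mset_set) (meson permutes_inj_on permutes_inv s)
  also have "\<dots> = mset_set ?I"
    using permutes_image[OF permutes_inv[OF s]] by simp
  finally show ?thesis
    using mset_w[of s] mset_w[of id] by simp
qed

lemma ell_permute_word: "s permutes {1..length w} \<Longrightarrow> ell (permute_word s w) = ell w"
  by (rule ext) (simp add: ell_def count_mset[symmetric] mset_permute_word)

abbreviation adj_transp :: "nat \<Rightarrow> nat \<Rightarrow> nat" where
  "adj_transp k \<equiv> Transposition.transpose k (Suc k)"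

lemma adj_transp_permutes: "k \<in> {1..<n} \<Longrightarrow> adj_transp k permutes {1..n}"
  by (rule permutes_swap_id) auto

lemma permute_word_adj_transp:
  "permute_word (adj_transp (Suc (length a))) (a @ [i, j] @ d) = a @ [j, i] @ d"
proof (rule nth_equalityI)
  fix x
  assume "x < length (permute_word (adj_transp (Suc (length a))) (a @ [i, j] @ d))"
  then have x: "x < length (a @ [i, j] @ d)" by simp
  have inv: "inv (adj_transp k) = adj_transp k" for k
    by (simp add: inv_equality)
  consider "x < length a" | "x = length a" | "x = Suc (length a)" | "x > Suc (length a)"
    by linarith
  then show "permute_word (adj_transp (Suc (length a))) (a @ [i, j] @ d) ! x = (a @ [j, i] @ d) ! x"
    unfolding nth_permute_word[OF x] inv
    by cases (auto simp: nth_append Transposition.transpose_def nth_Cons' )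
qed simp

lemma word_split:
  assumes "k \<in> {1..<length w}"
  obtains a i j d where "w = a @ [i, j] @ d" "k = Suc (length a)"
proof
  show "w = take (k - 1) w @ [w ! (k - 1), w ! k] @ drop (Suc k) w"
    using assms id_take_nth_drop[of "k - 1" w] Cons_nth_drop_Suc[of k w] by auto
  show "k = Suc (length (take (k - 1) w))"
    using assms by auto
qed

lemma perm_of_expr_simps:
  "perm_of_expr [] = id" "perm_of_expr (k # ks) = adj_transp k \<circ> perm_of_expr ks"
  by (simp_all add: perm_of_expr_def)

lemma perm_of_expr_permutes: "set ks \<subseteq> {1..<n} \<Longrightarrow> perm_of_expr ks permutes {1..n}"
  by (induction ks)
    (simp_all add: perm_of_expr_simps permutes_id[unfolded id_def] permutes_compose adj_transp_permutes del: One_nat_def)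


section \<open>Leading terms of the operators\<close>

locale q_relations =
  fixes b :: "'n::{finite,linorder} \<Rightarrow> 'n \<Rightarrow> complex"
    and p :: "'n \<Rightarrow> 'n \<Rightarrow> 'n tensor"
  assumes b_nonzero: "j < i \<Longrightarrow> b i j \<noteq> 0"
    and p_lower: "j < i \<Longrightarrow> p i j \<in> tensor.span {X k * X l | k l. k < i \<and> l < i}"
begin

primrec weight :: "'n list \<Rightarrow> complex" where
  "weight [] = 1"
| "weight (x # xs) = (\<Prod>y\<leftarrow>xs. if x < y then b y x else 1) * weight xs"

lemma weight_nonzero: "weight w \<noteq> 0"
  by (induction w) (auto simp: prod_list_zero_iff b_nonzero)

text \<open>Only the pair formed by the exchanged neighbours changes between ascending and
  descending; all other factors are merely reordered.\<close>

lemma weight_swap: "j < i \<Longrightarrow> weight (a @ [j, i] @ d) = b i j * weight (a @ [i, j] @ d)"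
  by (induction a) auto

definition wmonom :: "'n list \<Rightarrow> 'n tensor" where
  "wmonom w = scale (weight w) (monom w)"

lemma monom_eq_wmonom: "monom w = scale (inverse (weight w)) (wmonom w)"
  by (simp add: wmonom_def weight_nonzero)

lemma wmonom_in_supp_in: "w \<in> S \<Longrightarrow> wmonom w \<in> supp_in S"
  by (simp add: wmonom_def tensor.subspace_scale subspace_supp_in)

abbreviation \<sigma> :: "nat \<Rightarrow> 'n tensor \<Rightarrow> 'n tensor" where
  "\<sigma> \<equiv> sigma b p"

lemma linear_sigma: "tensor_linear (\<sigma> k)"
  unfolding sigma_def by (rule tensor_linear_lin_ext)

lemma sigma_monom:
  "\<sigma> (Suc (length a)) (monom (a @ [i, j] @ d)) = monom a * S_val b p i j * monom d"
  by (simp add: sigma_def nth_append)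

text \<open>The coefficient \<open>b i j\<close> of \<open>S\<close> is the quotient of the two
  weights, so the leading coefficient becomes 1.\<close>

lemma sigma_descent:
  assumes "j < i"
  shows "\<sigma> (Suc (length a)) (wmonom (a @ [i, j] @ d)) =
    wmonom (a @ [j, i] @ d) + scale (weight (a @ [i, j] @ d)) (monom a * p i j * monom d)"
proof -
  have "monom a * S_val b p i j * monom d = scale (b i j) (monom (a @ [j, i] @ d)) + monom a * p i j * monom d"
    using assms
    by (simp add: S_val_def X_def monom_mult scale_mult_left scale_mult_right distrib_left distrib_right)
  then show ?thesis
    unfolding wmonom_def tensor_linear_scale[OF linear_sigma] sigma_monom weight_swap[OF assms]
    by (simp add: tensor.scale_right_distrib mult.commute)
qed

text \<open>Written with the weight of the descending word, so that the \<open>p\<close> term is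
  exactly the negative of the one in \<open>sigma_descent\<close>.\<close>

lemma sigma_ascent:
  assumes "j < i"
  shows "\<sigma> (Suc (length a)) (wmonom (a @ [j, i] @ d)) =
    wmonom (a @ [i, j] @ d) - scale (weight (a @ [i, j] @ d)) (monom a * p i j * monom d)"
proof -
  have "monom a * S_val b p j i * monom d =
      scale (inverse (b i j)) (monom (a @ [i, j] @ d) - monom a * p i j * monom d)"
    using assms less_not_sym[OF assms]
    by (simp add: S_val_def X_def monom_mult scale_mult_left scale_mult_right left_diff_distrib right_diff_distrib)
  moreover have cancel: "b i j * x * inverse (b i j) = x" for x
    using b_nonzero[OF assms] by simp
  ultimately show ?thesis
    unfolding wmonom_def tensor_linear_scale[OF linear_sigma] sigma_monom weight_swap[OF assms]
    by (simp add: tensor.scale_right_diff_distrib cancel)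
qed

lemma sigma_plateau: "\<sigma> (Suc (length a)) (wmonom (a @ [i, i] @ d)) = wmonom (a @ [i, i] @ d)"
proof -
  have "monom a * S_val b p i i * monom d = monom (a @ [i, i] @ d)"
    by (simp add: S_val_def X_def monom_mult)
  then show ?thesis
    unfolding wmonom_def tensor_linear_scale[OF linear_sigma] sigma_monom by simp
qed

text \<open>At a valid position this is the weighted contribution of \<open>p\<close>: with plus
  sign at a descent, minus at an ascent, and zero at equal letters.\<close>

definition remainder :: "nat \<Rightarrow> 'n list \<Rightarrow> 'n tensor" where
  "remainder k w = \<sigma> k (wmonom w) - wmonom (permute_word (adj_transp k) w)"

lemma sigma_wmonom: "\<sigma> k (wmonom w) = wmonom (permute_word (adj_transp k) w) + remainder k w"
  by (simp add: remainder_def)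

text \<open>This antisymmetry makes the orbit sums below exactly invariant, although the operators
  need not satisfy the relations of the symmetric group.\<close>

lemma remainder_swap:
  assumes "k \<in> {1..<length w}"
  shows "remainder k (permute_word (adj_transp k) w) = - remainder k w"
proof -
  obtain a i j d where w: "w = a @ [i, j] @ d" and k: "k = Suc (length a)"
    using assms by (rule word_split)
  show ?thesis
    unfolding remainder_def w k permute_word_adj_transp
    by (cases i j rule: linorder_cases)
      (simp_all only: sigma_descent sigma_ascent sigma_plateau, simp_all)
qed

text \<open>Here the shape of \<open>p\<close> enters: its monomials put two letters below
  \<open>i\<close> in place of \<open>i\<close> and \<open>j\<close>.\<close>

lemma sandwich_p_below:
  assumes "j < i"
  shows "monom a * p i j * monom d \<in> supp_in (below (length (a @ [i, j] @ d)) (ell (a @ [i, j] @ d)))"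
proof (rule span_induct_linear[OF p_lower[OF assms] tensor_linear_sandwich subspace_supp_in])
  fix v
  assume "v \<in> {X k * X l | k l. k < i \<and> l < i}"
  then obtain k l where "v = X k * X l" "k < i" "l < i"
    by auto
  then show "monom a * v * monom d \<in> supp_in (below (length (a @ [i, j] @ d)) (ell (a @ [i, j] @ d)))"
    using below_replace_two[OF assms, of k l a d] by (simp add: X_def monom_mult)
qed

lemma below_swap: "below (length (a @ [j, i] @ d)) (ell (a @ [j, i] @ d)) =
    below (length (a @ [i, j] @ d)) (ell (a @ [i, j] @ d))"
proof -
  have "ell (a @ [j, i] @ d) = ell (a @ [i, j] @ d)"
    by (rule ext) (simp add: ell_def)
  then show ?thesis by simp
qed

lemma remainder_below:
  assumes "k \<in> {1..<length w}"
  shows "remainder k w \<in> supp_in (below (length w) (ell w))"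
proof -
  obtain a i j d where w: "w = a @ [i, j] @ d" and k: "k = Suc (length a)"
    using assms by (rule word_split)
  show ?thesis
  proof (cases i j rule: linorder_cases)
    case less
    then show ?thesis
      using sandwich_p_below[OF less, of a d]
      unfolding remainder_def w k permute_word_adj_transp sigma_ascent[OF less] below_swap[of a i j d]
      by (simp add: tensor.subspace_neg tensor.subspace_scale subspace_supp_in)
  next
    case equal
    then show ?thesis
      unfolding remainder_def w k permute_word_adj_transp
      by (simp only: sigma_plateau) (simp add: tensor.subspace_0 subspace_supp_in)
  next
    case greater
    then show ?thesis
      using sandwich_p_below[OF greater, of a d]
      unfolding remainder_def w k permute_word_adj_transp sigma_descent[OF greater]
      by (simp add: tensor.subspace_scale subspace_supp_in)
  qed
qed

text \<open>\<sigma> respects the order filtration: the exchange keeps the exponent vector and the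
  remainder lowers it.\<close>

lemma sigma_below:
  assumes "v \<in> supp_in (below n m)" "k \<in> {1..<n}"
  shows "\<sigma> k v \<in> supp_in (below n m)"
proof (rule supp_in_induct_linear[OF assms(1) linear_sigma subspace_supp_in])
  fix w
  assume w: "w \<in> below n m"
  then have n: "length w = n" by (simp add: below_def)
  have "permute_word (adj_transp k) w \<in> below n m"
    using w n ell_permute_word[of "adj_transp k" w] adj_transp_permutes[OF assms(2)] by (simp add: below_def)
  moreover have "remainder k w \<in> supp_in (below n m)"
    using remainder_below[of k w] supp_in_mono[OF psubset_imp_subset[OF below_psubset[OF w]]] assms(2) n
    by auto
  ultimately show "\<sigma> k (monom w) \<in> supp_in (below n m)"
    unfolding monom_eq_wmonom tensor_linear_scale[OF linear_sigma] sigma_wmonom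
    by (intro tensor.subspace_scale tensor.subspace_add subspace_supp_in wmonom_in_supp_in)
qed

lemma op_of_expr_simps:
  "op_of_expr b p [] = id" "op_of_expr b p (k # ks) = \<sigma> k \<circ> op_of_expr b p ks"
  by (simp_all add: op_of_expr_def)

lemma linear_op_of_expr: "tensor_linear (op_of_expr b p ks)"
proof (induction ks)
  case Nil
  show ?case
    unfolding op_of_expr_simps by (rule tensor_linear_id)
next
  case (Cons k ks)
  show ?case
    unfolding op_of_expr_simps by (rule Vector_Spaces.linear_compose[OF Cons linear_sigma])
qed

text \<open>Induction on the expression: modulo lower order each factor permutes letters, and
  \<sigma> never raises earlier errors. Hence all expressions of a permutation, reduced or not, have
  the same leading term.\<close>

lemma op_of_expr_wmonom:
  assumes "set ks \<subseteq> {1..<length w}"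
  shows "op_of_expr b p ks (wmonom w) - wmonom (permute_word (perm_of_expr ks) w)
    \<in> supp_in (below (length w) (ell w))"
  using assms
proof (induction ks)
  case Nil
  have "op_of_expr b p [] (wmonom w) - wmonom (permute_word (perm_of_expr []) w) = 0"
    unfolding op_of_expr_simps perm_of_expr_simps permute_word_id by simp
  then show ?case
    using tensor.subspace_0[OF subspace_supp_in] by simp
next
  case (Cons k ks)
  let ?w = "permute_word (perm_of_expr ks) w" and ?U = "supp_in (below (length w) (ell w))"
  have k: "k \<in> {1..<length w}" and ks: "perm_of_expr ks permutes {1..length w}"
    using Cons.prems perm_of_expr_permutes[of ks "length w"] by auto
  have "\<sigma> k (op_of_expr b p ks (wmonom w) - wmonom ?w) \<in> ?U"
    using Cons k by (intro sigma_below) auto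
  moreover have "remainder k ?w \<in> ?U"
    using remainder_below[of k ?w] k ks by (simp add: ell_permute_word)
  \<comment> \<open>The new error is the old one transported by \<sigma> plus one remainder.\<close>
  ultimately have "\<sigma> k (op_of_expr b p ks (wmonom w) - wmonom ?w) + remainder k ?w \<in> ?U"
    by (rule tensor.subspace_add[OF subspace_supp_in])
  moreover have "permute_word (perm_of_expr (k # ks)) w = permute_word (adj_transp k) ?w"
    unfolding perm_of_expr_simps by (rule permute_word_compose[OF adj_transp_permutes[OF k] ks])
  ultimately show ?case
    by (simp add: op_of_expr_simps tensor_linear_diff[OF linear_sigma] remainder_def)
qed

section \<open>Symmetrised monomials\<close>

definition symm :: "'n list \<Rightarrow> 'n tensor" where
  "symm w = scale (1 / fact (length w)) (\<Sum>s | s permutes {1..length w}. wmonom (permute_word s w))"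

text \<open>Right translation reindexes the sum; summing over all permutations, not over distinct
  words, keeps this valid for repeated letters.\<close>

lemma symm_permute_word:
  assumes "s permutes {1..length w}"
  shows "symm (permute_word s w) = symm w"
proof -
  have "(\<Sum>t | t permutes {1..length w}. wmonom (permute_word t w)) =
      (\<Sum>t | t permutes {1..length w}. wmonom (permute_word (t \<circ> s) w))"
    by (rule sum_permutations_compose_right[OF assms])
  also have "\<dots> = (\<Sum>t | t permutes {1..length w}. wmonom (permute_word t (permute_word s w)))"
    by (intro sum.cong refl arg_cong[of _ _ wmonom] permute_word_compose assms) simp
  finally show ?thesis
    by (simp add: symm_def)
qed

lemma symm_in_supp_in: "symm w \<in> supp_in {v. length v = length w \<and> ell v = ell w}"
  unfolding symm_def
  by (intro tensor.subspace_scale tensor.subspace_sum subspace_supp_in wmonom_in_supp_in)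
    (auto simp: ell_permute_word)

text \<open>Left translation by the transposition preserves the sum of leading terms and, by
  \<open>remainder_swap\<close>, turns the sum of remainders into its negative.\<close>

lemma sigma_symm:
  assumes k: "k \<in> {1..<length w}"
  shows "\<sigma> k (symm w) = symm w"
proof -
  let ?S = "{s. s permutes {1..length w}}" and ?t = "adj_transp k"
  have t: "?t permutes {1..length w}"
    by (rule adj_transp_permutes[OF k])
  have "(\<Sum>s\<in>?S. wmonom (permute_word s w)) = (\<Sum>s\<in>?S. wmonom (permute_word (?t \<circ> s) w))"
    by (rule setum_permutations_compose_left[OF t])
  also have "\<dots> = (\<Sum>s\<in>?S. wmonom (permute_word ?t (permute_word s w)))"
    by (intro sum.cong refl arg_cong[of _ _ wmonom] permute_word_compose t) simp
  finally have lead: "(\<Sum>s\<in>?S. wmonom (permute_word ?t (permute_word s w))) = (\<Sum>s\<in>?S. wmonom (permute_word s w))"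
    by simp
  let ?R = "\<Sum>s\<in>?S. remainder k (permute_word s w)"
  have "?R = (\<Sum>s\<in>?S. remainder k (permute_word (?t \<circ> s) w))"
    by (rule setum_permutations_compose_left[OF t])
  also have "\<dots> = (\<Sum>s\<in>?S. - remainder k (permute_word s w))"
  proof (rule sum.cong)
    fix s assume "s \<in> ?S"
    then have "permute_word (?t \<circ> s) w = permute_word ?t (permute_word s w)"
      by (intro permute_word_compose t) simp
    then show "remainder k (permute_word (?t \<circ> s) w) = - remainder k (permute_word s w)"
      using remainder_swap[of k "permute_word s w"] k by simp
  qed simp
  finally have "?R = - ?R"
    by (simp add: sum_negf)
  \<comment> \<open>A tensor equal to its own negative vanishes, as 2 is invertible.\<close>
  then have "scale 2 ?R = 0"
    using tensor.scale_left_distrib[of 1 1 ?R] by (simp add: eq_neg_iff_add_eq_0)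
  then have "?R = 0"
    by simp
  then show ?thesis
    by (simp add: symm_def tensor_linear_scale[OF linear_sigma] tensor_linear_sum[OF linear_sigma]
        sigma_wmonom sum.distrib lead del: One_nat_def)
qed


section \<open>The operators modulo the ideal\<close>

lemma two_sided_ideal_I_R: "two_sided_ideal (I_R b p)"
  unfolding I_R_def by (rule hull_in) (auto simp: two_sided_ideal_def)

lemma subspace_I_R: "tensor.subspace (I_R b p)"
  using two_sided_ideal_I_R by (auto simp: tensor.subspace_def two_sided_ideal_def scale_def)

lemma sandwich_rel_in_I_R: "j < i \<Longrightarrow> a * rel b p i j * d \<in> I_R b p"
  using two_sided_ideal_I_R hull_inc[of "rel b p i j" "{rel b p i j | i j. j < i}" two_sided_ideal]
  unfolding two_sided_ideal_def I_R_def by blast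

text \<open>Links the ideal to the operators: at a descent, a relation in context is the identity
  minus \<sigma>.\<close>

lemma sandwich_rel:
  assumes "j < i"
  shows "monom a * rel b p i j * monom d = monom (a @ [i, j] @ d) - \<sigma> (Suc (length a)) (monom (a @ [i, j] @ d))"
  using assms
  by (simp only: sigma_monom)
    (simp add: rel_def S_val_def X_def monom_mult scale_mult_left scale_mult_right algebra_simps)

text \<open>At an ascent the same relation appears, up to the inverse coefficient in
  \<open>S\<close>.\<close>

lemma sandwich_rel_ascent:
  assumes "j < i"
  shows "scale (inverse (b i j)) (monom a * rel b p i j * monom d) =
    \<sigma> (Suc (length a)) (monom (a @ [j, i] @ d)) - monom (a @ [j, i] @ d)"
  using assms less_not_sym[OF assms] b_nonzero[OF assms]
  by (simp only: sigma_monom)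
    (simp add: rel_def S_val_def X_def monom_mult scale_mult_left scale_mult_right algebra_simps
      tensor.scale_right_diff_distrib)

text \<open>\<sigma> is the identity modulo the ideal: on each monomial the difference is a multiple
  of a relation in context or zero.\<close>

lemma sigma_diff_in_I_R: "\<sigma> k u - u \<in> I_R b p"
proof (rule supp_in_induct_linear[OF _ tensor_linear_diff_id[OF linear_sigma] subspace_I_R])
  show "u \<in> supp_in UNIV" by (simp add: supp_in_def)
  fix w :: "'n list"
  show "\<sigma> k (monom w) - monom w \<in> I_R b p"
  proof (cases "k \<in> {1..<length w}")
    case False
    \<comment> \<open>Outside the valid positions the default value of \<open>sigma\<close> leaves
      the word alone.\<close>
    then have "\<sigma> k (monom w) = monom w"
      by (auto simp: sigma_def)
    then show ?thesis
      by (simp add: tensor.subspace_0 subspace_I_R)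
  next
    case True
    then obtain a i j d where w: "w = a @ [i, j] @ d" and k: "k = Suc (length a)"
      by (rule word_split)
    show ?thesis
    proof (cases i j rule: linorder_cases)
      case less
      show ?thesis
        unfolding w k sandwich_rel_ascent[OF less, symmetric]
        by (intro tensor.subspace_scale subspace_I_R sandwich_rel_in_I_R less)
    next
      case equal
      have "\<sigma> k (monom w) - monom w = 0"
        unfolding w k equal sigma_monom by (simp add: S_val_def X_def monom_mult)
      then show ?thesis
        by (simp add: tensor.subspace_0 subspace_I_R)
    next
      case greater
      have "- (monom w - \<sigma> k (monom w)) \<in> I_R b p"
        unfolding w k sandwich_rel[OF greater, symmetric]
        by (intro tensor.subspace_neg subspace_I_R sandwich_rel_in_I_R greater)
      then show ?thesis by simp
    qed
  qed
qed

lemma op_of_expr_diff_in_I_R: "op_of_expr b p ks u - u \<in> I_R b p"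
proof (induction ks)
  case Nil
  have "op_of_expr b p [] u - u = 0"
    unfolding op_of_expr_simps by simp
  then show ?case by (simp add: tensor.subspace_0 subspace_I_R)
next
  case (Cons k ks)
  have "op_of_expr b p (k # ks) u - u =
      (\<sigma> k (op_of_expr b p ks u) - op_of_expr b p ks u) + (op_of_expr b p ks u - u)"
    by (simp add: op_of_expr_simps)
  then show ?case
    using tensor.subspace_add[OF subspace_I_R sigma_diff_in_I_R Cons] by metis
qed

section \<open>The operator P modulo the ideal\<close>

lemma linear_P_op: "tensor_linear (P_op b p e)"
  unfolding P_op_def by (rule tensor_linear_lin_ext)

lemma P_op_monom: "P_op b p e (monom w) =
    scale (1 / fact (length w)) (\<Sum>s | s permutes {1..length w}. op_of_expr b p (e (length w) s) (monom w))"
  by (simp add: P_op_def P_deg_def)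

lemma P_op_wmonom: "P_op b p e (wmonom w) =
    scale (1 / fact (length w)) (\<Sum>s | s permutes {1..length w}. op_of_expr b p (e (length w) s) (wmonom w))"
  by (simp add: wmonom_def tensor_linear_scale[OF linear_P_op] tensor_linear_scale[OF linear_op_of_expr]
      P_op_monom tensor.scale_sum_right mult.commute)

lemma average_const: "scale (1 / fact n) (\<Sum>s | s permutes {1..n}. u) = u"
proof -
  have "(\<Sum>s | s permutes {1..n}. u) = scale (\<Sum>s | s permutes {1..n}. 1) u"
    unfolding tensor.scale_sum_left by simp
  moreover have "card {s. s permutes {1..n}} = fact n"
    by (rule card_permutations) simp_all
  ultimately show ?thesis
    by (simp del: One_nat_def)
qed

lemma P_op_diff_in_I_R: "P_op b p e u - u \<in> I_R b p"
proof (rule supp_in_induct_linear[OF _ tensor_linear_diff_id[OF linear_P_op] subspace_I_R])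
  show "u \<in> supp_in UNIV" by (simp add: supp_in_def)
  fix w :: "'n list"
  have "P_op b p e (monom w) - monom w = scale (1 / fact (length w))
      (\<Sum>s | s permutes {1..length w}. op_of_expr b p (e (length w) s) (monom w) - monom w)"
    unfolding sum_subtractf tensor.scale_right_diff_distrib average_const P_op_monom ..
  then show "P_op b p e (monom w) - monom w \<in> I_R b p"
    by (auto intro!: tensor.subspace_scale tensor.subspace_sum subspace_I_R op_of_expr_diff_in_I_R)
qed

lemma P_op_in_I_R: "u \<in> I_R b p \<Longrightarrow> P_op b p e u \<in> I_R b p"
  using tensor.subspace_add[OF subspace_I_R P_op_diff_in_I_R[of e u]] by force

lemma op_of_expr_fixed:
  assumes "set ks \<subseteq> K" "\<And>k. k \<in> K \<Longrightarrow> \<sigma> k u = u"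
  shows "op_of_expr b p ks u = u"
  using assms(1) by (induction ks) (auto simp: op_of_expr_simps assms(2))

text \<open>\<open>P_op\<close> uses the degree of each word separately; on a homogeneous tensor
  this is one common average.\<close>

lemma P_op_homog:
  assumes "u \<in> homog n"
  shows "P_op b p e u = scale (1 / fact n) (\<Sum>s | s permutes {1..n}. op_of_expr b p (e n s) u)"
    (is "_ = ?Q u")
proof -
  have "tensor_linear (\<lambda>u. P_op b p e u - ?Q u)"
    by (rule tensor_linearI)
      (simp_all add: tensor_linear_add[OF linear_P_op] tensor_linear_scale[OF linear_P_op]
        tensor_linear_add[OF linear_op_of_expr] tensor_linear_scale[OF linear_op_of_expr]
        sum.distrib tensor.scale_right_distrib tensor.scale_right_diff_distrib
        tensor.scale_sum_right mult.commute)
  \<comment> \<open>Taking the zero subspace as target shows that the linear difference of both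
    sides vanishes.\<close>
  from supp_in_induct_linear[OF assms[unfolded homog_eq_supp_in] this tensor.subspace_single_0]
  show ?thesis
    by (simp add: P_op_monom)
qed


section \<open>Fixed tensors and leading terms of P\<close>

lemma P_op_fixed:
  assumes "expr_choice e" "u \<in> homog n" "\<And>k. k \<in> {1..<n} \<Longrightarrow> \<sigma> k u = u"
  shows "P_op b p e u = u"
proof -
  have "op_of_expr b p (e n s) u = u" if "s permutes {1..n}" for s
    using assms that by (intro op_of_expr_fixed[of _ "{1..<n}"]) (auto simp: expr_choice_def)
  then have "(\<Sum>s | s permutes {1..n}. op_of_expr b p (e n s) u) = (\<Sum>s | s permutes {1..n}. u)"
    by (intro sum.cong) auto
  then show ?thesis
    unfolding P_op_homog[OF assms(2)] by (simp only: average_const)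
qed

lemma P_op_symm: "expr_choice e \<Longrightarrow> P_op b p e (symm w) = symm w"
  using symm_in_supp_in[of w]
  by (intro P_op_fixed[of e _ "length w"] sigma_symm) (auto simp: supp_in_def homog_def)

text \<open>Averages \<open>op_of_expr_wmonom\<close>: the expression for \<open>s\<close> acts on
  leading terms as \<open>s\<close>, so the choice affects only lower terms.\<close>

lemma P_op_wmonom_below:
  assumes "expr_choice e"
  shows "P_op b p e (wmonom w) - symm w \<in> supp_in (below (length w) (ell w))"
proof -
  let ?n = "length w"
  have "P_op b p e (wmonom w) - symm w = scale (1 / fact ?n)
      (\<Sum>s | s permutes {1..?n}. op_of_expr b p (e ?n s) (wmonom w) - wmonom (permute_word s w))"
    by (simp add: P_op_wmonom symm_def sum_subtractf tensor.scale_right_diff_distrib)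
  moreover have "op_of_expr b p (e ?n s) (wmonom w) - wmonom (permute_word s w) \<in> supp_in (below ?n (ell w))"
    if "s permutes {1..?n}" for s
  proof -
    have "set (e ?n s) \<subseteq> {1..<?n}" "perm_of_expr (e ?n s) = s"
      using assms that unfolding expr_choice_def by blast+
    then show ?thesis
      using op_of_expr_wmonom[of "e ?n s" w] by metis
  qed
  ultimately show ?thesis
    by (auto intro!: tensor.subspace_scale tensor.subspace_sum subspace_supp_in)
qed

text \<open>\<open>symm w\<close> keeps the exponent vector of \<open>w\<close>, so the leading part
  cannot leave the filtration step either.\<close>

lemma P_op_below:
  assumes "expr_choice e" "v \<in> supp_in (below n m)"
  shows "P_op b p e v \<in> supp_in (below n m)"
proof (rule supp_in_induct_linear[OF assms(2) linear_P_op subspace_supp_in])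
  fix w
  assume w: "w \<in> below n m"
  then have "{v. length v = length w \<and> ell v = ell w} \<subseteq> below n m" "below (length w) (ell w) \<subseteq> below n m"
    using below_psubset[OF w] by (auto simp: below_def)
  then have "symm w \<in> supp_in (below n m)" "P_op b p e (wmonom w) - symm w \<in> supp_in (below n m)"
    using symm_in_supp_in[of w] P_op_wmonom_below[OF assms(1), of w] supp_in_mono by blast+
  then have "P_op b p e (wmonom w) \<in> supp_in (below n m)"
    using tensor.subspace_add[OF subspace_supp_in] by fastforce
  then show "P_op b p e (monom w) \<in> supp_in (below n m)"
    unfolding monom_eq_wmonom tensor_linear_scale[OF linear_P_op]
    by (rule tensor.subspace_scale[OF subspace_supp_in])
qed

section \<open>Nilpotence on the ideal and the complementary fixed space\<close>

text \<open>The two leading terms of a relation lie in one orbit, so they have the same symmetrisation.\<close>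

lemma P_op_sandwich_rel:
  assumes e: "expr_choice e" and ji: "j < i"
  shows "P_op b p e (monom a * rel b p i j * monom d) \<in> supp_in (below (length (a @ [i, j] @ d)) (ell (a @ [i, j] @ d)))"
proof -
  define w where "w = a @ [i, j] @ d"
  define k where "k = Suc (length a)"
  let ?U = "supp_in (below (length w) (ell w))" and ?v = "permute_word (adj_transp k) w"
  have k: "k \<in> {1..<length w}"
    by (simp add: k_def w_def)
  have v: "symm ?v = symm w" "ell ?v = ell w"
    using adj_transp_permutes[OF k] by (auto simp: symm_permute_word ell_permute_word)
  have "(P_op b p e (wmonom w) - symm w) - (P_op b p e (wmonom ?v) - symm ?v) \<in> ?U"
    using P_op_wmonom_below[OF e, of w] P_op_wmonom_below[OF e, of ?v]
    unfolding v length_permute_word by (rule tensor.subspace_diff[OF subspace_supp_in])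
  \<comment> \<open>Subtracting the image of the remainder turns the exchanged monomial into
    \<open>\<sigma> k (wmonom w)\<close>.\<close>
  from tensor.subspace_diff[OF subspace_supp_in this P_op_below[OF e remainder_below[OF k]]]
  have "P_op b p e (wmonom w) - P_op b p e (wmonom ?v) - P_op b p e (remainder k w) \<in> ?U"
    by (simp add: v)
  then have "P_op b p e (wmonom w - \<sigma> k (wmonom w)) \<in> ?U"
    by (simp add: sigma_wmonom tensor_linear_diff[OF linear_P_op] tensor_linear_add[OF linear_P_op] diff_diff_eq)
  moreover have "monom a * rel b p i j * monom d = scale (inverse (weight w)) (wmonom w - \<sigma> k (wmonom w))"
    unfolding sandwich_rel[OF ji] w_def[symmetric] k_def[symmetric]
    by (simp add: monom_eq_wmonom tensor_linear_scale[OF linear_sigma] tensor.scale_right_diff_distrib)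
  ultimately show ?thesis
    unfolding w_def[symmetric]
    by (simp add: tensor_linear_scale[OF linear_P_op] tensor.subspace_scale[OF subspace_supp_in])
qed

text \<open>EA writes \<open>u\<close> through relations in context whose leading words do not
  exceed the order of \<open>u\<close>, and P lowers each of them strictly.\<close>

lemma P_op_decreases_order:
  assumes "EA b p" and e: "expr_choice e" and u: "u \<in> I_R b p" "u \<in> homog n" "u \<noteq> 0"
  shows "P_op b p e u \<in> supp_in (below n (tensor_order u))"
proof -
  have "u \<in> tensor.span {monom a * rel b p i j * monom d | a i j d.
      j < i \<and> length (a @ [i, j] @ d) = n \<and> ell (a @ [i, j] @ d) \<le>\<^sub>l tensor_order u}" (is "_ \<in> tensor.span ?B")
    using assms unfolding EA_def by blast
  then show ?thesis
  proof (rule span_induct_linear[OF _ linear_P_op subspace_supp_in])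
    fix v
    assume "v \<in> ?B"
    then obtain a i j d where v: "v = monom a * rel b p i j * monom d" "j < i"
      "length (a @ [i, j] @ d) = n" "ell (a @ [i, j] @ d) \<le>\<^sub>l tensor_order u"
      by blast
    show "P_op b p e v \<in> supp_in (below n (tensor_order u))"
      using P_op_sandwich_rel[OF e v(2), of a d] supp_in_mono[OF below_mono[OF v(4)], of n]
      unfolding v(1,3) by auto
  qed
qed

lemma funpow_P_op_0: "(P_op b p e ^^ M) 0 = 0"
  by (rule tensor_linear_0[OF tensor_linear_funpow[OF linear_P_op]])

text \<open>Induction on the number of words below the bound: P replaces the bound \<open>m\<close>
  by the order of \<open>u\<close>, which is strictly smaller.\<close>

lemma P_op_nilpotent_below:
  assumes "EA b p" "expr_choice e"
  shows "u \<in> I_R b p \<Longrightarrow> u \<in> supp_in (below n m) \<Longrightarrow> \<exists>M. (P_op b p e ^^ M) u = 0"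
proof (induction "card (below n m)" arbitrary: m u rule: less_induct)
  case less
  show ?case
  proof (cases "u = 0")
    case True
    then show ?thesis
      using funpow_P_op_0 by blast
  next
    case False
    have "u \<in> homog n"
      using less.prems by (auto simp: supp_in_def homog_def below_def)
    then have Pu: "P_op b p e u \<in> supp_in (below n (tensor_order u))"
      by (rule P_op_decreases_order[OF assms less.prems(1) _ False])
    \<comment> \<open>The order of \<open>u\<close> is attained by one of its words, which lies
      below \<open>m\<close>.\<close>
    obtain w where "w \<in> below n m" "tensor_order u = ell w"
      using tensor_order_props(1)[OF False] less.prems(2) by (auto simp: supp_in_def)
    then have "card (below n (tensor_order u)) < card (below n m)"
      using psubset_card_mono[OF finite_below below_psubset] by metis
    then obtain M where "(P_op b p e ^^ M) (P_op b p e u) = 0"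
      using less.hyps P_op_in_I_R[OF less.prems(1)] Pu by blast
    then have "(P_op b p e ^^ Suc M) u = 0"
      by (simp add: funpow_swap1)
    then show ?thesis ..
  qed
qed

text \<open>One application of P supplies the strict bound needed to start the induction.\<close>

lemma P_op_nilpotent:
  assumes EA: "EA b p" and e: "expr_choice e" and u: "u \<in> I_R b p" "u \<in> homog n"
  shows "\<exists>M. (P_op b p e ^^ M) u = 0"
proof (cases "u = 0")
  case True
  then show ?thesis
    using funpow_P_op_0 by blast
next
  case False
  obtain M where "(P_op b p e ^^ M) (P_op b p e u) = 0"
    using P_op_nilpotent_below[OF EA e P_op_in_I_R[OF u(1)] P_op_decreases_order[OF EA e u False]] by blast
  then have "(P_op b p e ^^ Suc M) u = 0"
    by (simp add: funpow_swap1)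
  then show ?thesis ..
qed

section \<open>The two complementary subspaces\<close>

definition vanishing :: "'n tensor set" where
  "vanishing = {u. \<forall>e. expr_choice e \<longrightarrow> (\<forall>\<^sub>F M in sequentially. (P_op b p e ^^ M) u = 0)}"

text \<open>Both \<open>vanishing\<close> and \<open>fixed\<close> quantify over all choices
  \<open>e\<close>; one decomposition then serves every choice, which yields independence of the
  limit.\<close>

definition fixed :: "'n tensor set" where
  "fixed = {u. \<forall>e. expr_choice e \<longrightarrow> P_op b p e u = u}"

lemma subspace_vanishing: "tensor.subspace vanishing"
proof (rule tensor.subspaceI)
  show "0 \<in> vanishing"
    by (simp add: vanishing_def funpow_P_op_0)
  show "u + v \<in> vanishing" if "u \<in> vanishing" "v \<in> vanishing" for u v
    unfolding vanishing_def mem_Collect_eq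
  proof (intro allI impI)
    fix e
    assume "expr_choice e"
    then have "\<forall>\<^sub>F M in sequentially. (P_op b p e ^^ M) u = 0" "\<forall>\<^sub>F M in sequentially. (P_op b p e ^^ M) v = 0"
      using that by (auto simp: vanishing_def)
    then show "\<forall>\<^sub>F M in sequentially. (P_op b p e ^^ M) (u + v) = 0"
      by eventually_elim (simp add: tensor_linear_add[OF tensor_linear_funpow[OF linear_P_op]])
  qed
  show "scale c u \<in> vanishing" if "u \<in> vanishing" for c u
    using that unfolding vanishing_def
    by (auto simp: tensor_linear_scale[OF tensor_linear_funpow[OF linear_P_op]] elim!: eventually_mono)
qed

lemma subspace_fixed: "tensor.subspace fixed"
  unfolding fixed_def
  by (rule tensor.subspaceI)
    (simp_all add: tensor_linear_0[OF linear_P_op] tensor_linear_add[OF linear_P_op] tensor_linear_scale[OF linear_P_op])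

text \<open>EA speaks about homogeneous elements, hence the degree hypothesis; once a power kills
  \<open>u\<close>, all later ones do.\<close>

lemma vanishingI:
  assumes "EA b p" "u \<in> I_R b p" "u \<in> homog n"
  shows "u \<in> vanishing"
  unfolding vanishing_def mem_Collect_eq
proof (intro allI impI)
  fix e
  assume "expr_choice e"
  then obtain M where M: "(P_op b p e ^^ M) u = 0"
    using P_op_nilpotent assms by blast
  have "(P_op b p e ^^ M') u = 0" if "M' \<ge> M" for M'
  proof -
    have "(P_op b p e ^^ (M' - M + M)) u = 0"
      unfolding funpow_add by (simp add: M funpow_P_op_0)
    then show ?thesis using that by simp
  qed
  then show "\<forall>\<^sub>F M in sequentially. (P_op b p e ^^ M) u = 0"
    by (auto simp: eventually_sequentially)
qed

text \<open>Removes the homogeneity restriction: relations in context are homogeneous and span the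
  ideal, and \<open>vanishing\<close> is a subspace.\<close>

lemma I_R_subset_vanishing:
  assumes EA: "EA b p"
  shows "I_R b p \<subseteq> vanishing"
proof -
  let ?B = "{monom a * rel b p i j * monom d | a i j d. j < i}"
  have "two_sided_ideal (tensor.span ?B)"
    unfolding two_sided_ideal_def
  proof (intro conjI ballI allI tensor.span_zero tensor.span_add; assumption?)
    fix u v
    assume u: "u \<in> tensor.span ?B"
    show "v * u \<in> tensor.span ?B"
    proof (rule supp_in_induct_linear[where f = "\<lambda>v. v * u"])
      show "v \<in> supp_in UNIV" by (simp add: supp_in_def)
      show "tensor_linear (\<lambda>v. v * u)"
        using tensor_linear_sandwich[of 1 u] by simp
      fix w
      have "monom w * u * 1 \<in> tensor.span ?B"
      proof (rule span_induct_linear[OF u tensor_linear_sandwich tensor.subspace_span])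
        fix x assume "x \<in> ?B"
        then obtain a i j d where "x = monom a * rel b p i j * monom d" "j < i" by blast
        then have "monom w * x * 1 = monom (w @ a) * rel b p i j * monom d"
          by (simp add: monom_mult[symmetric] mult.assoc)
        then show "monom w * x * 1 \<in> tensor.span ?B"
          using \<open>j < i\<close> by (intro tensor.span_base) blast
      qed
      then show "monom w * u \<in> tensor.span ?B" by simp
    qed (rule tensor.subspace_span)
    show "u * v \<in> tensor.span ?B"
    proof (rule supp_in_induct_linear[where f = "\<lambda>v. u * v"])
      show "v \<in> supp_in UNIV" by (simp add: supp_in_def)
      show "tensor_linear (\<lambda>v. u * v)"
        using tensor_linear_sandwich[of u 1] by simp
      fix w
      have "1 * u * monom w \<in> tensor.span ?B"
      proof (rule span_induct_linear[OF u tensor_linear_sandwich tensor.subspace_span])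
        fix x assume "x \<in> ?B"
        then obtain a i j d where "x = monom a * rel b p i j * monom d" "j < i" by blast
        then have "1 * x * monom w = monom a * rel b p i j * monom (d @ w)"
          by (simp add: monom_mult[symmetric] mult.assoc)
        then show "1 * x * monom w \<in> tensor.span ?B"
          using \<open>j < i\<close> by (intro tensor.span_base) blast
      qed
      then show "u * monom w \<in> tensor.span ?B" by simp
    qed (rule tensor.subspace_span)
  qed
  moreover have "{rel b p i j | i j. j < i} \<subseteq> tensor.span ?B"
  proof safe
    fix i j :: 'n
    assume "j < i"
    then have "monom [] * rel b p i j * monom [] \<in> tensor.span ?B"
      by (intro tensor.span_base) blast
    then show "rel b p i j \<in> tensor.span ?B"
      by simp
  qed
  ultimately have "I_R b p \<subseteq> tensor.span ?B"
    unfolding I_R_def by (intro hull_minimal)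
  also have "tensor.span ?B \<subseteq> vanishing"
  proof (rule tensor.span_minimal[OF _ subspace_vanishing], safe)
    fix a d :: "'n list" and i j :: 'n
    assume ji: "j < i"
    \<comment> \<open>Homogeneity of a relation in context; for the \<open>p\<close> term it follows
      from \<open>sandwich_p_below\<close>.\<close>
    have "scale (b i j) (monom (a @ [j, i] @ d)) + monom a * p i j * monom d \<in> homog (length (a @ [i, j] @ d))"
      using sandwich_p_below[OF ji, of a d] unfolding homog_eq_supp_in
      by (intro tensor.subspace_add tensor.subspace_scale subspace_supp_in) (auto simp: supp_in_def below_def)
    then have "monom (a @ [i, j] @ d) - (scale (b i j) (monom (a @ [j, i] @ d)) + monom a * p i j * monom d)
        \<in> homog (length (a @ [i, j] @ d))"
      unfolding homog_eq_supp_in by (intro tensor.subspace_diff subspace_supp_in) auto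
    moreover have "monom a * rel b p i j * monom d =
        monom (a @ [i, j] @ d) - (scale (b i j) (monom (a @ [j, i] @ d)) + monom a * p i j * monom d)"
      by (simp add: rel_def X_def monom_mult scale_mult_left scale_mult_right algebra_simps)
    ultimately show "monom a * rel b p i j * monom d \<in> vanishing"
      using vanishingI[OF EA sandwich_rel_in_I_R[OF ji]] by metis
  qed
  finally show ?thesis .
qed

text \<open>Induction on the number of lower words: \<open>wmonom w\<close> is a tensor of lower
  words, minus an element of the ideal, plus the fixed tensor \<open>symm w\<close>.\<close>

lemma monom_decomposition:
  assumes EA: "EA b p" and e: "expr_choice e"
  shows "monom w \<in> {u + v | u v. u \<in> vanishing \<and> v \<in> fixed}" (is "_ \<in> ?D")
proof (induction "card (below (length w) (ell w))" arbitrary: w rule: less_induct)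
  case less
  have D: "tensor.subspace ?D"
    by (rule tensor.subspace_sums[OF subspace_vanishing subspace_fixed])
  have "monom v \<in> ?D" if "v \<in> below (length w) (ell w)" for v
  proof (rule less)
    have "length v = length w" using that by (simp add: below_def)
    then show "card (below (length v) (ell v)) < card (below (length w) (ell w))"
      using psubset_card_mono[OF finite_below below_psubset[OF that]] by simp
  qed
  then have "supp_in (below (length w) (ell w)) \<subseteq> ?D"
    unfolding supp_in_eq_span by (intro tensor.span_minimal D) auto
  then have "P_op b p e (wmonom w) - symm w \<in> ?D"
    using P_op_wmonom_below[OF e] by blast
  moreover have "P_op b p e (wmonom w) - wmonom w \<in> ?D"
  proof -
    have "P_op b p e (wmonom w) - wmonom w \<in> vanishing"
      using I_R_subset_vanishing[OF EA] P_op_diff_in_I_R by blast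
    then have "P_op b p e (wmonom w) - wmonom w + 0 \<in> ?D"
      using tensor.subspace_0[OF subspace_fixed] by blast
    then show ?thesis by simp
  qed
  moreover have "symm w \<in> ?D"
  proof -
    have "symm w \<in> fixed"
      by (simp add: fixed_def P_op_symm)
    then have "0 + symm w \<in> ?D"
      using tensor.subspace_0[OF subspace_vanishing] by blast
    then show ?thesis by simp
  qed
  ultimately have "(P_op b p e (wmonom w) - symm w) - (P_op b p e (wmonom w) - wmonom w) + symm w \<in> ?D"
    by (rule tensor.subspace_add[OF D tensor.subspace_diff[OF D]])
  then have "wmonom w \<in> ?D"
    by simp
  then show ?case
    unfolding monom_eq_wmonom by (rule tensor.subspace_scale[OF D])
qed

lemma decomposition:
  assumes "EA b p" "expr_choice e"
  obtains v where "v \<in> fixed" "u - v \<in> vanishing"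
proof -
  have "u \<in> supp_in UNIV"
    by (simp add: supp_in_def)
  also have "supp_in UNIV \<subseteq> {u + v | u v. u \<in> vanishing \<and> v \<in> fixed}"
    unfolding supp_in_eq_span
    by (intro tensor.span_minimal tensor.subspace_sums[OF subspace_vanishing subspace_fixed])
      (auto intro!: monom_decomposition[OF assms, simplified])
  finally obtain x v where "u = x + v" "x \<in> vanishing" "v \<in> fixed"
    by blast
  then show ?thesis
    using that[of v] by simp
qed

lemma eventually_funpow_P_op:
  assumes e: "expr_choice e" and v: "v \<in> fixed" "u - v \<in> vanishing"
  shows "\<forall>\<^sub>F M in sequentially. (P_op b p e ^^ M) u = v"
proof -
  have "(P_op b p e ^^ M) v = v" for M
    by (induction M) (use e v(1) in \<open>auto simp: fixed_def\<close>)
  then have "(P_op b p e ^^ M) u = v" if "(P_op b p e ^^ M) (u - v) = 0" for M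
    using that by (simp add: tensor_linear_diff[OF tensor_linear_funpow[OF linear_P_op]])
  moreover have "\<forall>\<^sub>F M in sequentially. (P_op b p e ^^ M) (u - v) = 0"
    using e v(2) by (simp add: vanishing_def)
  ultimately show ?thesis
    by (auto elim: eventually_mono)
qed

text \<open>Any decomposition determines the limit, since two eventual values agree from some point
  on. Later claims thus need only a decomposition.\<close>

lemma P_qsym_eqI:
  assumes "expr_choice e" "v \<in> fixed" "u - v \<in> vanishing"
  shows "P_qsym b p e u = v"
  unfolding P_qsym_def
proof (rule the_equality)
  show *: "\<forall>\<^sub>F M in sequentially. (P_op b p e ^^ M) u = v"
    by (rule eventually_funpow_P_op[OF assms])
  fix v'
  assume "\<forall>\<^sub>F M in sequentially. (P_op b p e ^^ M) u = v'"
  then have "\<forall>\<^sub>F M in sequentially. v' = v"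
    using * by eventually_elim simp
  then show "v' = v" by simp
qed

end

section \<open>The limit projection\<close>

theorem proposition5p15:
  fixes q :: complex
    and \<alpha> :: "'n::{finite,linorder} \<Rightarrow> 'n \<Rightarrow> complex"
    and b :: "'n \<Rightarrow> 'n \<Rightarrow> complex"
    and p :: "'n \<Rightarrow> 'n \<Rightarrow> 'n tensor"
  assumes q: "q \<noteq> 0"
    and b: "\<And>i j. j < i \<Longrightarrow> b i j = q powr \<alpha> i j"
    and p: "\<And>i j. j < i \<Longrightarrow> p i j \<in> tensor.span {X k * X l | k l. k < i \<and> l < i}"
    and EA: "EA b p"
  shows "(\<forall>e. expr_choice e \<longrightarrow>
            (\<forall>n. \<forall>u \<in> homog n. \<exists>v. \<forall>\<^sub>F M in sequentially. (P_op b p e ^^ M) u = v)) \<and>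
         (\<forall>e e'. expr_choice e \<and> expr_choice e' \<longrightarrow> P_qsym b p e = P_qsym b p e') \<and>
         (\<forall>e. expr_choice e \<longrightarrow>
            Vector_Spaces.linear scale scale (P_qsym b p e) \<and>
            P_qsym b p e \<circ> P_qsym b p e = P_qsym b p e \<and>
            (\<forall>u \<in> I_R b p. P_qsym b p e u = 0))"
proof -
  interpret q_relations b p
    \<comment> \<open>\<open>powr\<close> with a nonzero base is nonzero, which gives
      \<open>b_nonzero\<close>.\<close>
    by unfold_locales (use q b p in auto)
  \<comment> \<open>The limit is the fixed component of \<open>u\<close>.\<close>
  have P_qsym_props: "P_qsym b p e u \<in> fixed" "u - P_qsym b p e u \<in> vanishing" if "expr_choice e" for e u
    by (metis decomposition[OF EA that] P_qsym_eqI[OF that])+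
  have ev: "\<exists>v. \<forall>\<^sub>F M in sequentially. (P_op b p e ^^ M) u = v" if "expr_choice e" for e u
    using eventually_funpow_P_op[OF that P_qsym_props[OF that]] by blast
  \<comment> \<open>The decomposition obtained for \<open>e'\<close> also serves \<open>e\<close>,
    because the two subspaces do not depend on the choice.\<close>
  have unique: "P_qsym b p e = P_qsym b p e'" if "expr_choice e" "expr_choice e'" for e e'
    by (rule ext) (rule P_qsym_eqI[OF that(1) P_qsym_props[OF that(2)]])
  have linear: "tensor_linear (P_qsym b p e)" if e: "expr_choice e" for e
  proof (rule tensor_linearI)
    fix u v c
    have "u + v - (P_qsym b p e u + P_qsym b p e v) = (u - P_qsym b p e u) + (v - P_qsym b p e v)"
      by simp
    also have "\<dots> \<in> vanishing"
      by (intro tensor.subspace_add subspace_vanishing P_qsym_props e)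
    finally show "P_qsym b p e (u + v) = P_qsym b p e u + P_qsym b p e v"
      by (intro P_qsym_eqI tensor.subspace_add subspace_fixed P_qsym_props e)
    have "scale c u - scale c (P_qsym b p e u) \<in> vanishing"
      unfolding tensor.scale_right_diff_distrib[symmetric]
      by (intro tensor.subspace_scale subspace_vanishing P_qsym_props e)
    then show "P_qsym b p e (scale c u) = scale c (P_qsym b p e u)"
      by (intro P_qsym_eqI tensor.subspace_scale subspace_fixed P_qsym_props e)
  qed
  have idem: "P_qsym b p e \<circ> P_qsym b p e = P_qsym b p e" if e: "expr_choice e" for e
  proof
    fix u
    \<comment> \<open>A fixed tensor decomposes with vanishing part 0.\<close>
    have "P_qsym b p e (P_qsym b p e u) = P_qsym b p e u"
      by (rule P_qsym_eqI[OF e P_qsym_props(1)[OF e]]) (simp add: tensor.subspace_0[OF subspace_vanishing])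
    then show "(P_qsym b p e \<circ> P_qsym b p e) u = P_qsym b p e u"
      by simp
  qed
  \<comment> \<open>An element of the ideal lies entirely in \<open>vanishing\<close>, so its fixed
    component is 0.\<close>
  have kills: "P_qsym b p e u = 0" if e: "expr_choice e" and u: "u \<in> I_R b p" for e u
    using I_R_subset_vanishing[OF EA] u
    by (intro P_qsym_eqI[OF e]) (auto simp: tensor.subspace_0[OF subspace_fixed])
  show ?thesis
    using ev unique linear idem kills by blast
qed

end
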